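(* Let $\mathcal X,\mathcal Y$ be $\mathcal K$-representable, let $\overline{\mathcal X}$ be a $\mathcal K$-representable subset of $\mathbb R^n$, and let $\mathbf U\in\mathcal K$ be a cone in $\mathbb R^n$. Let $\overline\psi:\overline{\mathcal X}\times\mathcal Y\to\mathbb R$ be a continuous convex-concave function which is $\mathbf U$-nondecreasing in its first argument, i.e. $$\overline x',\overline x''\in\overline{\mathcal X},\ \overline x'\leq_{\mathbf U}\overline x'',\ y\in\mathcal Y\ \Rightarrow\ \overline\psi(\overline x'',y)\geq\overline\psi(\overline x',y),$$ and which admits the $\mathcal K$-representation $$\overline\psi(\overline x,y)=\inf_{f,t,\overline u}\{f^Ty+t:\overline Pf+t\overline p+\overline Q\,\overline u+\overline R\,\overline x\leq_{\overline{\mathbf K}}\overline s\}\quad\forall\overline x\in\overline{\mathcal X},\ y\in\mathcal Y\qquad[\overline{\mathbf K}\in\mathcal K].$$ Let $x\mapsto X(x):\mathcal X\to\overline{\mathcal X}$ be a $\mathbf U$-convex mapping such that $$\{(x,\overline x): x\in\mathcal X,\ \overline x\in\overline{\mathcal X},\ \overline x\geq_{\mathbf U}X(x)\}=\{(x,\overline x):\exists v: Ax+B\overline x+Cv\leq_{\widehat{\mathbf K}}d\}\qquad[\widehat{\mathbf K}\in\mathcal K].$$ Then the function $\psi(x,y)=\overline\psi(X(x),y)$ admits on $\mathcal X\times\mathcal Y$ the $\mathcal K$-representation $$\psi(x,y)=\inf_{f,t,\overline u,\overline x,v}\left\{f^Ty+t:\ \begin{array}{l}Ax+B\overline x+Cv\leq_{\widehat{\mathbf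 K}}d,\\ \overline Pf+t\overline p+\overline Q\,\overline u+\overline R\,\overline x\leq_{\overline{\mathbf K}}\overline s\end{array}\right\}\quad\forall x\in\mathcal X,\ y\in\mathcal Y.$$
   Context: $\mathcal K$ is a fixed family of regular cones (closed, convex, pointed, with nonempty interior) in Euclidean spaces which contains $\mathbb R_+$, is closed under finite direct products, and is closed under passing to dual cones. $a\leq_{\mathbf K}b$ means $b-a\in\mathbf K$. A set $X$ is $\mathcal K$-representable if $X=\{x:\exists u:Ax+Bu\leq_{\mathbf K}c\}$ for some $A,B,c$ and $\mathbf K\in\mathcal K$. Finite systems of $\mathcal K$-conic constraints, linear equalities and nonstrict linear inequalities are (equivalent to) a single $\mathcal K$-conic constraint. A mapping $X(\cdot)$ is $\mathbf U$-convex if $X(\lambda x'+(1-\lambda)x'')\leq_{\mathbf U}\lambda X(x')+(1-\lambda)X(x'')$ for all $x',x''\in\mathcal X$, $\lambda\in[0,1]$. Convex-concave means convex in the first and concave in the second argument. A function $\psi:\mathcal X\times\mathcal Y\to\mathbb R$ admits a $\mathcal K$-representation on $\mathcal X\times\mathcal Y$ if $\psi(x,y)=\inf_{f,t,u}\{f^Ty+t:Pf+tp+Qu+Rx\leq_{\mathbf K}s\}$ for all $x\in\mathcal X,y\in\mathcal Y$, with some $\mathbf K\in\mathcal K$ (the constraint may be given as an equivalent finite system). *)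

theory Defs
  imports "HOL-Analysis.Abstract_Euclidean_Space" "HOL-Library.Extended_Real"
    "Jordan_Normal_Form.Matrix"
begin

no_notation inner (infixl \<open>\<bullet>\<close> 70)

text \<open>All dimensions vary inside the statement, so a vector of \<open>\<real>\<^sup>n\<close> is an element of
  \<^term>\<open>carrier_vec n\<close>. The topology of \<open>\<real>\<^sup>n\<close> is transported from
  \<^const>\<open>Euclidean_space\<close>, whose points are the sequences vanishing from index \<open>n\<close> on.\<close>

definition Rn_topology :: "nat \<Rightarrow> real vec topology" where
  "Rn_topology n =
     pullback_topology (carrier_vec n) (\<lambda>v i. if i < n then v $ i else 0) (Euclidean_space n)"

definition regular_cone :: "nat \<Rightarrow> real vec set \<Rightarrow> bool" where
  "regular_cone n K \<longleftrightarrow>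
     K \<subseteq> carrier_vec n \<and>
     (\<forall>v\<in>K. \<forall>a\<ge>0. a \<cdot>\<^sub>v v \<in> K) \<and>
     (\<forall>v\<in>K. \<forall>w\<in>K. \<forall>a\<in>{0..1}. a \<cdot>\<^sub>v v + (1 - a) \<cdot>\<^sub>v w \<in> K) \<and>
     closedin (Rn_topology n) K \<and>
     (\<forall>v\<in>K. - v \<in> K \<longrightarrow> v = 0\<^sub>v n) \<and>
     Rn_topology n interior_of K \<noteq> {}"

definition nonneg_ray :: "real vec set" where
  "nonneg_ray = {v \<in> carrier_vec 1. v $ 0 \<ge> 0}"

definition cone_product :: "real vec set \<Rightarrow> real vec set \<Rightarrow> real vec set" where
  "cone_product K L = {v @\<^sub>v w | v w. v \<in> K \<and> w \<in> L}"

definition dual_cone :: "nat \<Rightarrow> real vec set \<Rightarrow> real vec set" where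
  "dual_cone n K = {w \<in> carrier_vec n. \<forall>v\<in>K. w \<bullet> v \<ge> 0}"

definition cone_family :: "real vec set set \<Rightarrow> bool" where
  "cone_family \<K> \<longleftrightarrow>
     (\<forall>K\<in>\<K>. \<exists>n. regular_cone n K) \<and>
     nonneg_ray \<in> \<K> \<and>
     (\<forall>K\<in>\<K>. \<forall>L\<in>\<K>. cone_product K L \<in> \<K>) \<and>
     (\<forall>K\<in>\<K>. \<forall>n. K \<subseteq> carrier_vec n \<longrightarrow> dual_cone n K \<in> \<K>)"

definition cone_le :: "real vec set \<Rightarrow> real vec \<Rightarrow> real vec \<Rightarrow> bool" where
  "cone_le K a b \<longleftrightarrow> b - a \<in> K"

definition representable_set :: "real vec set set \<Rightarrow> nat \<Rightarrow> real vec set \<Rightarrow> bool" where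
  "representable_set \<K> n S \<longleftrightarrow>
     (\<exists>K\<in>\<K>. \<exists>N k A B c. K \<subseteq> carrier_vec N \<and>
        A \<in> carrier_mat N n \<and> B \<in> carrier_mat N k \<and> c \<in> carrier_vec N \<and>
        S = {x \<in> carrier_vec n. \<exists>u\<in>carrier_vec k. cone_le K (A *\<^sub>v x + B *\<^sub>v u) c})"

definition cone_convex_map ::
    "real vec set \<Rightarrow> real vec set \<Rightarrow> (real vec \<Rightarrow> real vec) \<Rightarrow> bool" where
  "cone_convex_map U S F \<longleftrightarrow>
     (\<forall>x\<in>S. \<forall>x'\<in>S. \<forall>a\<in>{0..1}.
        cone_le U (F (a \<cdot>\<^sub>v x + (1 - a) \<cdot>\<^sub>v x')) (a \<cdot>\<^sub>v F x + (1 - a) \<cdot>\<^sub>v F x'))"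

definition convex_concave_on ::
    "real vec set \<Rightarrow> real vec set \<Rightarrow> (real vec \<Rightarrow> real vec \<Rightarrow> real) \<Rightarrow> bool" where
  "convex_concave_on S T \<psi> \<longleftrightarrow>
     (\<forall>x\<in>S. \<forall>x'\<in>S. \<forall>y\<in>T. \<forall>a\<in>{0..1}.
        \<psi> (a \<cdot>\<^sub>v x + (1 - a) \<cdot>\<^sub>v x') y \<le> a * \<psi> x y + (1 - a) * \<psi> x' y) \<and>
     (\<forall>x\<in>S. \<forall>y\<in>T. \<forall>y'\<in>T. \<forall>a\<in>{0..1}.
        a * \<psi> x y + (1 - a) * \<psi> x y' \<le> \<psi> x (a \<cdot>\<^sub>v y + (1 - a) \<cdot>\<^sub>v y'))"

definition continuous_on_product ::
    "nat \<Rightarrow> nat \<Rightarrow> real vec set \<Rightarrow> real vec set \<Rightarrow> (real vec \<Rightarrow> real vec \<Rightarrow> real) \<Rightarrow> bool" where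
  "continuous_on_product n m S T \<psi> \<longleftrightarrow>
     continuous_map
       (prod_topology (subtopology (Rn_topology n) S) (subtopology (Rn_topology m) T))
       euclideanreal (\<lambda>(x, y). \<psi> x y)"

definition cone_nondecreasing_on ::
    "real vec set \<Rightarrow> real vec set \<Rightarrow> real vec set \<Rightarrow> (real vec \<Rightarrow> real vec \<Rightarrow> real) \<Rightarrow> bool" where
  "cone_nondecreasing_on U S T \<psi> \<longleftrightarrow>
     (\<forall>x\<in>S. \<forall>x'\<in>S. \<forall>y\<in>T. cone_le U x x' \<longrightarrow> \<psi> x' y \<ge> \<psi> x y)"

definition rep_constraint ::
    "real vec set \<Rightarrow> real mat \<Rightarrow> real vec \<Rightarrow> real mat \<Rightarrow> real mat \<Rightarrow> real vec \<Rightarrow>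
     real vec \<Rightarrow> real \<Rightarrow> real vec \<Rightarrow> real vec \<Rightarrow> bool" where
  "rep_constraint K P p Q R s f t u x \<longleftrightarrow>
     cone_le K (P *\<^sub>v f + t \<cdot>\<^sub>v p + Q *\<^sub>v u + R *\<^sub>v x) s"

text \<open>The data \<open>K, P, p, Q, R, s\<close>, with auxiliary variable \<open>u\<close> in \<open>\<real>\<^sup>k\<close>, represent \<open>\<psi>\<close> on
  \<open>S \<times> T\<close>, where \<open>S \<subseteq> \<real>\<^sup>n\<close> and \<open>T \<subseteq> \<real>\<^sup>m\<close>. The infimum is taken in the extended reals because
  the infimum of an empty or unbounded set of reals is unspecified.\<close>

definition conic_representation ::
    "real vec set set \<Rightarrow> nat \<Rightarrow> nat \<Rightarrow> nat \<Rightarrow> real vec set \<Rightarrow> real vec set \<Rightarrow>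
     (real vec \<Rightarrow> real vec \<Rightarrow> real) \<Rightarrow>
     real vec set \<Rightarrow> real mat \<Rightarrow> real vec \<Rightarrow> real mat \<Rightarrow> real mat \<Rightarrow> real vec \<Rightarrow> bool" where
  "conic_representation \<K> n m k S T \<psi> K P p Q R s \<longleftrightarrow>
     K \<in> \<K> \<and>
     (\<exists>N. K \<subseteq> carrier_vec N \<and> P \<in> carrier_mat N m \<and> p \<in> carrier_vec N \<and>
        Q \<in> carrier_mat N k \<and> R \<in> carrier_mat N n \<and> s \<in> carrier_vec N) \<and>
     (\<forall>x\<in>S. \<forall>y\<in>T. ereal (\<psi> x y) =
        (INF (f, t, u) \<in> {(f, t, u). f \<in> carrier_vec m \<and> u \<in> carrier_vec k \<and>
                             rep_constraint K P p Q R s f t u x}.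
           ereal (f \<bullet> y + t)))"

end

(* Monotonicity makes xb = X x the best choice among all xb \<in> DXb with X x \<le> xb, and these xb
   are exactly the ones the second conic system describes; hence adding xb as a variable and
   minimising over it recovers \<psi>b (X x) y. *)
theory Submission
  imports Defs
begin

lemma append_vec_minus:
  fixes v v' w w' :: "'a :: group_add vec"
  assumes "v \<in> carrier_vec n" "v' \<in> carrier_vec n" "w \<in> carrier_vec m" "w' \<in> carrier_vec m"
  shows "(v @\<^sub>v w) - (v' @\<^sub>v w') = (v - v') @\<^sub>v (w - w')"
  using assms by (intro eq_vecI) auto

lemma zero_mat_mult_vec:
  fixes v :: "'a :: semiring_0 vec"
  assumes "v \<in> carrier_vec n"
  shows "0\<^sub>m m n *\<^sub>v v = 0\<^sub>v m"
  using assms by (intro eq_vecI) auto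

text \<open>Lower blocks with no rows turn \<open>four_block_mat\<close> into the horizontal
  juxtaposition of \<open>A\<close> and \<open>B\<close>, so the product has an empty lower part.
  This form is used to add the columns of one more auxiliary variable to a system.\<close>

lemma append_cols_mult_vec:
  fixes A B :: "'a :: semiring_0 mat"
  assumes A: "A \<in> carrier_mat m n1" and B: "B \<in> carrier_mat m n2"
    and v: "v \<in> carrier_vec n1" and w: "w \<in> carrier_vec n2"
  shows "four_block_mat A B (0\<^sub>m 0 n1) (0\<^sub>m 0 n2) *\<^sub>v (v @\<^sub>v w) = A *\<^sub>v v + B *\<^sub>v w"
  unfolding four_block_mat_mult_vec[OF A B zero_carrier_mat zero_carrier_mat v w]
  using assms by (intro eq_vecI) auto

text \<open>A concatenated vector does not record where its parts meet; the dimension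
  \<open>m\<close> of \<open>K\<close> fixes the cut and makes the two components of the difference
  unique. This is what lets one product cone carry two conic constraints.\<close>

lemma cone_le_product:
  assumes K: "K \<subseteq> carrier_vec m"
    and v: "a \<in> carrier_vec m" "b \<in> carrier_vec m" "a' \<in> carrier_vec m'" "b' \<in> carrier_vec m'"
  shows "cone_le (cone_product K L) (a @\<^sub>v a') (b @\<^sub>v b') \<longleftrightarrow> cone_le K a b \<and> cone_le L a' b'"
proof -
  have "v = b - a \<and> w = b' - a'" if "(b - a) @\<^sub>v (b' - a') = v @\<^sub>v w" "v \<in> K" for v w
    using that v K append_vec_eq[of "b - a" m v "b' - a'" w] by auto
  then show ?thesis
    unfolding cone_le_def cone_product_def append_vec_minus[OF v(2,1,4,3)] by blast
qed

lemma representable_set_carrier: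
  "representable_set \<K> n S \<Longrightarrow> S \<subseteq> carrier_vec n"
  unfolding representable_set_def by auto

text \<open>A nonempty interior supplies some point of the cone, and scaling it by 0 gives the
  origin. The dimension \<open>m\<close> is the one hidden by the existential in
  \<open>cone_family\<close>, while \<open>n\<close> is the ambient dimension in which the origin is
  wanted.\<close>

lemma regular_cone_zero:
  assumes "regular_cone m K" "K \<subseteq> carrier_vec n"
  shows "0\<^sub>v n \<in> K"
proof -
  have "Rn_topology m interior_of K \<subseteq> K"
    by (rule interior_of_subset)
  then obtain v where v: "v \<in> K"
    using assms(1) unfolding regular_cone_def by blast
  then have "0 \<cdot>\<^sub>v v \<in> K"
    using assms(1) unfolding regular_cone_def by auto
  moreover have "0 \<cdot>\<^sub>v v = 0\<^sub>v n"
    using v assms(2) by (intro eq_vecI) auto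
  ultimately show ?thesis by simp
qed

theorem mainTheorem8:
  fixes \<K> :: "real vec set set"
    and nx ny n k q N :: nat
    and DX DY DXb U :: "real vec set"
    and \<psi>b :: "real vec \<Rightarrow> real vec \<Rightarrow> real"
    and Kb Kh :: "real vec set"
    and Pb Qb Rb A B C :: "real mat"
    and pb sb d :: "real vec"
    and X :: "real vec \<Rightarrow> real vec"
  assumes "cone_family \<K>"
    and "representable_set \<K> nx DX"
    and "representable_set \<K> ny DY"
    and "representable_set \<K> n DXb"
    and "U \<in> \<K>" and "U \<subseteq> carrier_vec n"
    and "continuous_on_product n ny DXb DY \<psi>b"
    and "convex_concave_on DXb DY \<psi>b"
    and "cone_nondecreasing_on U DXb DY \<psi>b"
    and "conic_representation \<K> n ny k DXb DY \<psi>b Kb Pb pb Qb Rb sb"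
    and "\<forall>x\<in>DX. X x \<in> DXb"
    and "cone_convex_map U DX X"
    and "Kh \<in> \<K>" and "Kh \<subseteq> carrier_vec N"
    and "A \<in> carrier_mat N nx" and "B \<in> carrier_mat N n" and "C \<in> carrier_mat N q"
    and "d \<in> carrier_vec N"
    and "{(x, xb). x \<in> DX \<and> xb \<in> DXb \<and> cone_le U (X x) xb} =
         {(x, xb). x \<in> carrier_vec nx \<and> xb \<in> carrier_vec n \<and>
            (\<exists>v\<in>carrier_vec q. cone_le Kh (A *\<^sub>v x + B *\<^sub>v xb + C *\<^sub>v v) d)}"
  shows "(\<forall>x\<in>DX. \<forall>y\<in>DY. ereal (\<psi>b (X x) y) =
            (INF (f, t, u, xb, v) \<in> {(f, t, u, xb, v).
                 f \<in> carrier_vec ny \<and> u \<in> carrier_vec k \<and>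
                 xb \<in> carrier_vec n \<and> v \<in> carrier_vec q \<and>
                 cone_le Kh (A *\<^sub>v x + B *\<^sub>v xb + C *\<^sub>v v) d \<and>
                 cone_le Kb (Pb *\<^sub>v f + t \<cdot>\<^sub>v pb + Qb *\<^sub>v u + Rb *\<^sub>v xb) sb}.
               ereal (f \<bullet> y + t))) \<and>
         (\<exists>K P p Q R s.
            conic_representation \<K> nx ny (k + n + q) DX DY (\<lambda>x y. \<psi>b (X x) y) K P p Q R s \<and>
            (\<forall>f\<in>carrier_vec ny. \<forall>t. \<forall>u\<in>carrier_vec k. \<forall>xb\<in>carrier_vec n.
               \<forall>v\<in>carrier_vec q. \<forall>x\<in>carrier_vec nx.
                 rep_constraint K P p Q R s f t (u @\<^sub>v xb @\<^sub>v v) x \<longleftrightarrow>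
                 cone_le Kh (A *\<^sub>v x + B *\<^sub>v xb + C *\<^sub>v v) d \<and>
                 cone_le Kb (Pb *\<^sub>v f + t \<cdot>\<^sub>v pb + Qb *\<^sub>v u + Rb *\<^sub>v xb) sb))"
proof -
  \<comment> \<open>The origin in \<open>U\<close> is the reflexivity of the order, which will make
    the choice \<open>xb = X x\<close> feasible.\<close>
  have U0: "0\<^sub>v n \<in> U"
    using assms(1,5,6) regular_cone_zero unfolding cone_family_def by blast
  have DX: "DX \<subseteq> carrier_vec nx" and DXb: "DXb \<subseteq> carrier_vec n"
    using assms(2,4) representable_set_carrier by auto
  from assms(10) obtain Nb where Kb: "Kb \<in> \<K>" "Kb \<subseteq> carrier_vec Nb"
    and Pb: "Pb \<in> carrier_mat Nb ny" and pb: "pb \<in> carrier_vec Nb"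
    and Qb: "Qb \<in> carrier_mat Nb k" and Rb: "Rb \<in> carrier_mat Nb n"
    and sb: "sb \<in> carrier_vec Nb"
    and rep: "\<And>x y. x \<in> DXb \<Longrightarrow> y \<in> DY \<Longrightarrow> ereal (\<psi>b x y) =
        (INF (f, t, u) \<in> {(f, t, u). f \<in> carrier_vec ny \<and> u \<in> carrier_vec k \<and>
                             rep_constraint Kb Pb pb Qb Rb sb f t u x}.
           ereal (f \<bullet> y + t))"
    unfolding conic_representation_def by blast
  note A = assms(15) and B = assms(16) and C = assms(17) and d = assms(18)
  have epi: "x \<in> DX \<and> xb \<in> DXb \<and> cone_le U (X x) xb \<longleftrightarrow>
      x \<in> carrier_vec nx \<and> xb \<in> carrier_vec n \<and>
        (\<exists>v\<in>carrier_vec q. cone_le Kh (A *\<^sub>v x + B *\<^sub>v xb + C *\<^sub>v v) d)" for x xb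
    using arg_cong[OF assms(19), of "\<lambda>S. (x, xb) \<in> S"] by simp
  let ?F = "\<lambda>x. {(f, t, u, xb, v).
                 f \<in> carrier_vec ny \<and> u \<in> carrier_vec k \<and>
                 xb \<in> carrier_vec n \<and> v \<in> carrier_vec q \<and>
                 cone_le Kh (A *\<^sub>v x + B *\<^sub>v xb + C *\<^sub>v v) d \<and>
                 cone_le Kb (Pb *\<^sub>v f + t \<cdot>\<^sub>v pb + Qb *\<^sub>v u + Rb *\<^sub>v xb) sb}"
  have inf: "ereal (\<psi>b (X x) y) = (INF (f, t, u, xb, v) \<in> ?F x. ereal (f \<bullet> y + t))"
    if x: "x \<in> DX" and y: "y \<in> DY" for x y
  proof (rule antisym)
    show "ereal (\<psi>b (X x) y) \<le> (INF (f, t, u, xb, v) \<in> ?F x. ereal (f \<bullet> y + t))"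
    proof (rule INF_greatest, clarify)
      fix f t u xb v
      assume h: "f \<in> carrier_vec ny" "u \<in> carrier_vec k" "xb \<in> carrier_vec n"
          "v \<in> carrier_vec q" "cone_le Kh (A *\<^sub>v x + B *\<^sub>v xb + C *\<^sub>v v) d"
          "cone_le Kb (Pb *\<^sub>v f + t \<cdot>\<^sub>v pb + Qb *\<^sub>v u + Rb *\<^sub>v xb) sb"
      \<comment> \<open>The conic system alone places \<open>xb\<close> in \<open>DXb\<close> and
        above \<open>X x\<close>, so both monotonicity and the representation of
        \<open>\<psi>b\<close> at \<open>xb\<close> become applicable.\<close>
      then have xb: "xb \<in> DXb" "cone_le U (X x) xb"
        using epi[of x xb] x DX by blast+
      then have "\<psi>b (X x) y \<le> \<psi>b xb y"
        using assms(9,11) x y unfolding cone_nondecreasing_on_def by blast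
      moreover have "ereal (\<psi>b xb y) \<le> ereal (f \<bullet> y + t)"
        unfolding rep[OF xb(1) y]
        by (rule INF_lower2[of "(f, t, u)"]) (use h in \<open>auto simp: rep_constraint_def\<close>)
      ultimately show "ereal (\<psi>b (X x) y) \<le> ereal (f \<bullet> y + t)"
        by simp
    qed
  next
    have Xx: "X x \<in> DXb" using assms(11) x by blast
    then have "X x - X x = 0\<^sub>v n" using DXb by auto
    then have "cone_le U (X x) (X x)"
      using U0 unfolding cone_le_def by simp
    \<comment> \<open>This \<open>v\<close> depends on \<open>x\<close> only, so the same one
      completes every triple \<open>(f, t, u)\<close> below.\<close>
    then obtain v where v: "v \<in> carrier_vec q"
        "cone_le Kh (A *\<^sub>v x + B *\<^sub>v X x + C *\<^sub>v v) d"
      using epi[of x "X x"] x Xx by blast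
    \<comment> \<open>With the right side written as an infimum at \<open>X x\<close>, each of its
      feasible triples extends by \<open>X x\<close> and \<open>v\<close> to a feasible point with
      the same objective value.\<close>
    show "(INF (f, t, u, xb, v) \<in> ?F x. ereal (f \<bullet> y + t)) \<le> ereal (\<psi>b (X x) y)"
      unfolding rep[OF Xx y]
    proof (rule INF_greatest, clarify)
      fix f t u
      assume "f \<in> carrier_vec ny" "u \<in> carrier_vec k"
        "rep_constraint Kb Pb pb Qb Rb sb f t u (X x)"
      then show "(INF (f, t, u, xb, v) \<in> ?F x. ereal (f \<bullet> y + t)) \<le> ereal (f \<bullet> y + t)"
        using v Xx DXb
        by (intro INF_lower2[of "(f, t, u, X x, v)"]) (auto simp: rep_constraint_def)
    qed
  qed
  \<comment> \<open>The two constraints are stacked, the \<open>N\<close> rows for \<open>Kh\<close>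
    on top and the \<open>Nb\<close> rows for \<open>Kb\<close> below. The top rows of
    \<open>P\<close> and \<open>p\<close> vanish because \<open>f\<close> and \<open>t\<close> occur
    only in the second constraint; the bottom rows of \<open>R\<close> vanish because
    \<open>x\<close> enters that one only through \<open>xb\<close>.\<close>
  define K where "K = cone_product Kh Kb"
  define P where "P = 0\<^sub>m N ny @\<^sub>r Pb"
  define p where "p = 0\<^sub>v N @\<^sub>v pb"
  \<comment> \<open>The columns belong to \<open>u\<close>, \<open>xb\<close>, \<open>v\<close> in
    this order: the top rows are \<open>0, B, C\<close> and the bottom rows
    \<open>Qb, Rb, 0\<close>. The outer block matrix only juxtaposes, hence its lower blocks without
    rows.\<close>
  define Q where "Q = four_block_mat (0\<^sub>m N k @\<^sub>r Qb) (four_block_mat B C Rb (0\<^sub>m Nb q))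
     (0\<^sub>m 0 k) (0\<^sub>m 0 (n + q))"
  define R where "R = A @\<^sub>r 0\<^sub>m Nb nx"
  define s where "s = d @\<^sub>v sb"
  have dims: "K \<subseteq> carrier_vec (N + Nb)" "P \<in> carrier_mat (N + Nb) ny"
    "p \<in> carrier_vec (N + Nb)" "R \<in> carrier_mat (N + Nb) nx" "s \<in> carrier_vec (N + Nb)"
    unfolding K_def cone_product_def P_def p_def R_def s_def
    using Kb(2) assms(14) Pb pb A d sb by auto
  \<comment> \<open>The summand 0 counts the rows of the empty lower blocks.\<close>
  have "Q \<in> carrier_mat (N + Nb + 0) (k + (n + q))"
    unfolding Q_def by (intro four_block_carrier_mat carrier_append_rows) (use B Qb in auto)
  then have dimQ: "Q \<in> carrier_mat (N + Nb) (k + n + q)"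
    by (simp add: add.assoc)
  have KK: "K \<in> \<K>"
    unfolding K_def using assms(1,13) Kb(1) unfolding cone_family_def by blast
  have constr: "rep_constraint K P p Q R s f t (u @\<^sub>v xb @\<^sub>v v) x \<longleftrightarrow>
      cone_le Kh (A *\<^sub>v x + B *\<^sub>v xb + C *\<^sub>v v) d \<and>
      cone_le Kb (Pb *\<^sub>v f + t \<cdot>\<^sub>v pb + Qb *\<^sub>v u + Rb *\<^sub>v xb) sb"
    if f: "f \<in> carrier_vec ny" and u: "u \<in> carrier_vec k" and xb: "xb \<in> carrier_vec n"
      and v: "v \<in> carrier_vec q" and x: "x \<in> carrier_vec nx" for f t u xb v x
  proof -
    have "P *\<^sub>v f = 0\<^sub>v N @\<^sub>v Pb *\<^sub>v f"
      unfolding P_def mat_mult_append[OF zero_carrier_mat Pb f] zero_mat_mult_vec[OF f] ..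
    moreover have "t \<cdot>\<^sub>v p = 0\<^sub>v N @\<^sub>v t \<cdot>\<^sub>v pb"
      unfolding p_def using pb by (intro eq_vecI) auto
    moreover have "R *\<^sub>v x = A *\<^sub>v x @\<^sub>v 0\<^sub>v Nb"
      unfolding R_def mat_mult_append[OF A zero_carrier_mat x] zero_mat_mult_vec[OF x] ..
    moreover have "Q *\<^sub>v (u @\<^sub>v xb @\<^sub>v v) =
        (0\<^sub>m N k @\<^sub>r Qb) *\<^sub>v u + four_block_mat B C Rb (0\<^sub>m Nb q) *\<^sub>v (xb @\<^sub>v v)"
      unfolding Q_def using B Qb u xb v by (intro append_cols_mult_vec[where m = "N + Nb"]) auto
    then have "Q *\<^sub>v (u @\<^sub>v xb @\<^sub>v v) =
        (0\<^sub>v N @\<^sub>v Qb *\<^sub>v u) + ((B *\<^sub>v xb + C *\<^sub>v v) @\<^sub>v (Rb *\<^sub>v xb + 0\<^sub>v Nb))"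
      unfolding mat_mult_append[OF zero_carrier_mat Qb u] zero_mat_mult_vec[OF u]
        four_block_mat_mult_vec[OF B C Rb zero_carrier_mat xb v] zero_mat_mult_vec[OF v] .
    \<comment> \<open>Adding the four concatenations part by part, the zero summands drop out and
      the remaining ones are reordered into the two original left-hand sides.\<close>
    ultimately have "P *\<^sub>v f + t \<cdot>\<^sub>v p + Q *\<^sub>v (u @\<^sub>v xb @\<^sub>v v) + R *\<^sub>v x =
        (A *\<^sub>v x + B *\<^sub>v xb + C *\<^sub>v v) @\<^sub>v (Pb *\<^sub>v f + t \<cdot>\<^sub>v pb + Qb *\<^sub>v u + Rb *\<^sub>v xb)"
      using A B C Pb Qb Rb pb f u xb v x by (intro eq_vecI) auto
    then show ?thesis
      unfolding rep_constraint_def K_def s_def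
      using A B C Pb Qb Rb pb f u xb v x d sb
      by (simp add: cone_le_product[OF assms(14), where m' = Nb])
  qed
  have "ereal (\<psi>b (X x) y) =
      (INF (f, t, w) \<in> {(f, t, w). f \<in> carrier_vec ny \<and> w \<in> carrier_vec (k + n + q) \<and>
                         rep_constraint K P p Q R s f t w x}. ereal (f \<bullet> y + t))"
    (is "_ = Inf (?h ` ?G)") if x: "x \<in> DX" and y: "y \<in> DY" for x y
  proof -
    have xc: "x \<in> carrier_vec nx" using x DX by blast
    \<comment> \<open>Gluing the three auxiliary variables leaves \<open>f\<close> and
      \<open>t\<close> untouched, hence also the objective. Once \<open>?j\<close> maps
      \<open>?F x\<close> onto \<open>?G\<close>, both infima range over the same set of
      values.\<close>
    let ?j = "\<lambda>(f, t, u, xb, v). (f, t, u @\<^sub>v xb @\<^sub>v v)"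
    have "?j ` ?F x = ?G"
    proof (intro equalityI subsetI)
      fix z assume "z \<in> ?j ` ?F x"
      then show "z \<in> ?G" using xc by (auto simp: constr add.assoc)
    next
      fix z assume "z \<in> ?G"
      then obtain f t w where z: "z = (f, t, w)" "f \<in> carrier_vec ny"
          "w \<in> carrier_vec (k + (n + q))" "rep_constraint K P p Q R s f t w x"
        by (auto simp: add.assoc)
      \<comment> \<open>Surjectivity: \<open>w\<close> is cut after \<open>k\<close> and after
        \<open>k + n\<close> entries, which undoes the gluing.\<close>
      define u where "u = vec_first w k"
      define xb where "xb = vec_first (vec_last w (n + q)) n"
      define v where "v = vec_last (vec_last w (n + q)) q"
      have w: "w = u @\<^sub>v xb @\<^sub>v v"
        unfolding u_def xb_def v_def using z(3) by simp
      have c: "u \<in> carrier_vec k" "xb \<in> carrier_vec n" "v \<in> carrier_vec q"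
        unfolding u_def xb_def v_def by auto
      have "(f, t, u, xb, v) \<in> ?F x"
        using z(2,4) c xc unfolding w by (simp add: constr)
      then show "z \<in> ?j ` ?F x"
        unfolding z(1) w by (rule rev_image_eqI) simp
    qed
    then have "?h ` ?G = (?h \<circ> ?j) ` ?F x"
      by (metis image_comp)
    also have "?h \<circ> ?j = (\<lambda>(f, t, u, xb, v). ereal (f \<bullet> y + t))"
      by auto
    finally show ?thesis
      using inf[OF x y] by simp
  qed
  then have "conic_representation \<K> nx ny (k + n + q) DX DY (\<lambda>x y. \<psi>b (X x) y) K P p Q R s"
    unfolding conic_representation_def using KK dims dimQ by blast
  then show ?thesis
    using inf constr by blast
qed

end
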